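(* For every finite coloring of $\mathbb{N}$ there exists $\lambda\in\mathbb{N}$ such that for every $k\in\mathbb{N}$ there exist a finite set $A\subseteq\mathbb{N}$ which contains a $k$-term arithmetic progression and contains a $k$-FS, and a set $B\subseteq\mathbb{N}$ which is central in $(\mathbb{N},+)$, such that the set \[\lambda A\cup\lambda B\cup\lambda(A+B)\cup AB\] is monochromatic.
   Context: $\mathbb{N}=\{1,2,3,\dots\}$. For nonempty $A,B\subseteq\mathbb{N}$ and $x\in\mathbb{N}$: $A+B=\{a+b:a\in A,b\in B\}$, $AB=\{ab:a\in A,b\in B\}$, $xA=\{xa:a\in A\}$. A set $A$ contains a $k$-term arithmetic progression if $\{a,a+d,\dots,a+(k-1)d\}\subseteq A$ for some $a,d\in\mathbb{N}$. A set $A$ contains a $k$-FS if there are $a_1,\dots,a_k\in\mathbb{N}$ with $\{\sum_{i\in F}a_i: \emptyset\neq F\subseteq\{1,\dots,k\}\}\subseteq A$. Central sets: for a semigroup $(S,+)$ (here $S=\mathbb{N}$ with addition), $\beta S$ is the set of ultrafilters on $S$ with the topology generated by the sets $\{p: E\in p\}$, $E\subseteq S$; the operation extends to $\beta S$ by $A\in p+q$ iff $\{s\in S: A-s\in q\}\in p$, where $A-s=\{t\in S:s+t\in A\}$, making $\beta S$ a compact right topological semigroup. A minimal idempotent is an idempotent ($p+p=p$) lying in the smallest two-sided ideal of $(\beta S,+)$ (equivalently, in some minimal left ideal). A set $A\subseteq S$ is central in $(S,+)$ if $A\in p$ for some minimal idempotent $p$ of $(\beta S,+)$. *)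

theory Defs
  imports Main "HOL-Library.Set_Algebras"
begin

text \<open>
  The natural numbers \<open>{1, 2, 3, \<dots>}\<close> are the set \<open>pnat\<close> inside the type \<open>nat\<close>. Semigroups are given by a carrier set \<open>S\<close>, assumed closed under
  the ambient associative addition.
\<close>

definition pnat :: "nat set" where
  "pnat = {n. 1 \<le> n}"

text \<open>The elements of \<open>\<beta>S\<close> are represented as families of subsets of \<open>S\<close>.\<close>

definition ultrafilter_on :: "'a set \<Rightarrow> 'a set set \<Rightarrow> bool" where
  "ultrafilter_on S p \<longleftrightarrow>
     p \<subseteq> Pow S \<and> S \<in> p \<and> {} \<notin> p \<and>
     (\<forall>A\<in>p. \<forall>B\<in>p. A \<inter> B \<in> p) \<and>
     (\<forall>A\<in>p. \<forall>B. A \<subseteq> B \<and> B \<subseteq> S \<longrightarrow> B \<in> p) \<and>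
     (\<forall>A. A \<subseteq> S \<longrightarrow> A \<in> p \<or> S - A \<in> p)"

definition beta :: "'a set \<Rightarrow> 'a set set set" where
  "beta S = {p. ultrafilter_on S p}"

text \<open>The inner set is \<open>A - s = {t \<in> S. s + t \<in> A}\<close>.\<close>

definition beta_add :: "'a::semigroup_add set \<Rightarrow> 'a set set \<Rightarrow> 'a set set \<Rightarrow> 'a set set" where
  "beta_add S p q = {A. A \<subseteq> S \<and> {s \<in> S. {t \<in> S. s + t \<in> A} \<in> q} \<in> p}"

definition two_sided_ideal :: "'a::semigroup_add set \<Rightarrow> 'a set set set \<Rightarrow> bool" where
  "two_sided_ideal S I \<longleftrightarrow>
     I \<noteq> {} \<and> I \<subseteq> beta S \<and>
     (\<forall>p\<in>I. \<forall>q\<in>beta S. beta_add S p q \<in> I \<and> beta_add S q p \<in> I)"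

definition smallest_ideal :: "'a::semigroup_add set \<Rightarrow> 'a set set set \<Rightarrow> bool" where
  "smallest_ideal S K \<longleftrightarrow>
     two_sided_ideal S K \<and> (\<forall>I. two_sided_ideal S I \<longrightarrow> K \<subseteq> I)"

definition minimal_idempotent :: "'a::semigroup_add set \<Rightarrow> 'a set set \<Rightarrow> bool" where
  "minimal_idempotent S p \<longleftrightarrow>
     p \<in> beta S \<and> beta_add S p p = p \<and> (\<exists>K. smallest_ideal S K \<and> p \<in> K)"

definition central_in :: "'a::semigroup_add set \<Rightarrow> 'a set \<Rightarrow> bool" where
  "central_in S A \<longleftrightarrow> A \<subseteq> S \<and> (\<exists>p. minimal_idempotent S p \<and> A \<in> p)"

definition contains_AP :: "nat \<Rightarrow> nat set \<Rightarrow> bool" where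
  "contains_AP k A \<longleftrightarrow> (\<exists>a\<in>pnat. \<exists>d\<in>pnat. {a + i * d | i. i < k} \<subseteq> A)"

definition contains_FS :: "nat \<Rightarrow> nat set \<Rightarrow> bool" where
  "contains_FS k A \<longleftrightarrow>
     (\<exists>a :: nat \<Rightarrow> nat. (\<forall>i\<in>{1..k}. a i \<in> pnat) \<and>
        {\<Sum>i\<in>F. a i | F. F \<noteq> {} \<and> F \<subseteq> {1..k}} \<subseteq> A)"

definition monochromatic :: "('a \<Rightarrow> 'c) \<Rightarrow> 'a set \<Rightarrow> bool" where
  "monochromatic c X \<longleftrightarrow> (\<exists>j. \<forall>x\<in>X. c x = j)"

end

theory Submission
  imports Defs
begin

text \<open>
  Let \<open>q\<close> be a minimal idempotent of \<open>(\<beta>\<nat>,+)\<close>. Some colour class \<open>C\<close> belongs to the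
  multiplicative product \<open>q \<odot> q\<close>, that is, \<open>E = {n. C/n \<in> q} \<in> q\<close>. Choose \<open>\<lambda> \<in> E\<close> and put
  \<open>D = C/\<lambda> \<in> q\<close>. As \<open>q\<close> is idempotent, \<open>D\<^sup>\<star> = {a \<in> D. D - a \<in> q}\<close> lies in \<open>q\<close>, so \<open>E \<inter> D\<^sup>\<star>\<close> contains
  arithmetic progressions and finite sums sets; a finite piece \<open>A\<close> of it works together with
  \<open>B = D \<inter> \<Inter>\<^bsub>a\<in>A\<^esub> ((D - a) \<inter> C/a) \<in> q\<close>.

  That members of \<open>q\<close> contain \<open>k\<close>-term progressions is shown by induction on \<open>k\<close>: the ultrafilters
  all of whose members contain \<open>k\<close>-term progressions form a two-sided ideal as soon as there is
  one, and hence contain \<open>q\<close>; given this, a colour focusing argument along \<open>q\<close> finds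
  monochromatic progressions of length \<open>k + 1\<close> in every finite colouring.
\<close>

section \<open>Ultrafilters on a set\<close>

lemma
  assumes u: "ultrafilter_on S p"
  shows ultrafilter_on_subset: "A \<in> p \<Longrightarrow> A \<subseteq> S"
    and ultrafilter_on_univ: "S \<in> p"
    and ultrafilter_on_empty: "{} \<notin> p"
    and ultrafilter_on_Int: "A \<in> p \<Longrightarrow> B \<in> p \<Longrightarrow> A \<inter> B \<in> p"
    and ultrafilter_on_mono: "A \<in> p \<Longrightarrow> A \<subseteq> B \<Longrightarrow> B \<subseteq> S \<Longrightarrow> B \<in> p"
    and ultrafilter_on_compl: "A \<subseteq> S \<Longrightarrow> A \<notin> p \<Longrightarrow> S - A \<in> p"
proof -
  have *: "p \<subseteq> Pow S" "S \<in> p" "{} \<notin> p"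
    "\<forall>A\<in>p. \<forall>B\<in>p. A \<inter> B \<in> p"
    "\<forall>A\<in>p. \<forall>B. A \<subseteq> B \<and> B \<subseteq> S \<longrightarrow> B \<in> p"
    "\<forall>A. A \<subseteq> S \<longrightarrow> A \<in> p \<or> S - A \<in> p"
    using u unfolding ultrafilter_on_def by - (elim conjE, assumption)+
  show "A \<in> p \<Longrightarrow> A \<subseteq> S" using *(1) by auto
  show "S \<in> p" "{} \<notin> p" by fact+
  show "A \<in> p \<Longrightarrow> B \<in> p \<Longrightarrow> A \<inter> B \<in> p" using *(4) by simp
  show "A \<in> p \<Longrightarrow> A \<subseteq> B \<Longrightarrow> B \<subseteq> S \<Longrightarrow> B \<in> p" using *(5) by simp
  show "A \<subseteq> S \<Longrightarrow> A \<notin> p \<Longrightarrow> S - A \<in> p" using *(6) by auto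
qed

lemma ultrafilter_on_compl_iff:
  assumes "ultrafilter_on S p" "A \<subseteq> S"
  shows "S - A \<in> p \<longleftrightarrow> A \<notin> p"
  using ultrafilter_on_Int[OF assms(1), of A "S - A"] ultrafilter_on_empty[OF assms(1)]
    ultrafilter_on_compl[OF assms] by auto

lemma ultrafilter_on_Int_iff:
  assumes "ultrafilter_on S p" "A \<subseteq> S" "B \<subseteq> S"
  shows "A \<inter> B \<in> p \<longleftrightarrow> A \<in> p \<and> B \<in> p"
  using ultrafilter_on_Int[OF assms(1)] ultrafilter_on_mono[OF assms(1), of "A \<inter> B"] assms(2,3)
  by (meson inf_le1 inf_le2)

lemma ultrafilter_on_Collect_ball:
  assumes u: "ultrafilter_on S p" and "finite I"
    and "\<And>i. i \<in> I \<Longrightarrow> {s \<in> S. P i s} \<in> p"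
  shows "{s \<in> S. \<forall>i\<in>I. P i s} \<in> p"
  using assms(2,3)
proof (induction I)
  case empty
  then show ?case using ultrafilter_on_univ[OF u] by simp
next
  case (insert i I)
  have "{s \<in> S. \<forall>i\<in>insert i I. P i s} = {s \<in> S. P i s} \<inter> {s \<in> S. \<forall>i\<in>I. P i s}" by auto
  then show ?case using insert ultrafilter_on_Int[OF u] by simp
qed

lemma ultrafilter_on_nonempty:
  assumes "ultrafilter_on S p" "{s \<in> S. P s} \<in> p"
  obtains s where "s \<in> S" "P s"
  using assms ultrafilter_on_empty[OF assms(1)] by (metis (no_types, lifting) Collect_empty_eq)

text \<open>If no colour class were in \<open>p\<close>, all their complements would be. As there
  are finitely many colours, the intersection of these complements would lie in \<open>p\<close>,
  yet it is empty.\<close>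

lemma ultrafilter_on_colour:
  assumes u: "ultrafilter_on S p" and fin: "finite (c ` S)"
  obtains j where "{s \<in> S. c s = j} \<in> p"
proof (rule ccontr)
  assume "\<not> thesis"
  then have "\<And>j. {s \<in> S. c s = j} \<notin> p" using that by blast
  moreover have "{s \<in> S. c s \<noteq> j} = S - {s \<in> S. c s = j}" for j by auto
  ultimately have "{s \<in> S. c s \<noteq> j} \<in> p" for j
    using ultrafilter_on_compl[OF u, of "{s \<in> S. c s = j}"] by simp
  then have "{s \<in> S. \<forall>j\<in>c ` S. c s \<noteq> j} \<in> p"
    by (intro ultrafilter_on_Collect_ball[OF u fin])
  then show False by (rule ultrafilter_on_nonempty[OF u]) auto
qed

text \<open>Ultrafilters are maximal: a set of \<open>q\<close> outside \<open>p\<close> would have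
  its complement in \<open>p\<close>, hence in \<open>q\<close>. Equalities of ultrafilters below
  thus need one inclusion only.\<close>

lemma ultrafilter_on_subset_eq:
  assumes "ultrafilter_on S p" "ultrafilter_on S q" "p \<subseteq> q"
  shows "p = q"
proof (intro subset_antisym[OF assms(3)] subsetI)
  fix A assume A: "A \<in> q"
  have "A \<subseteq> S" using ultrafilter_on_subset[OF assms(2) A] .
  then show "A \<in> p"
    using ultrafilter_on_compl[OF assms(1)] ultrafilter_on_compl_iff[OF assms(2)] A assms(3) by blast
qed

section \<open>Finite intersection property and extension to ultrafilters\<close>

definition fip :: "'a set \<Rightarrow> 'a set set \<Rightarrow> bool" where
  "fip S M \<longleftrightarrow> M \<subseteq> Pow S \<and> (\<forall>F. F \<subseteq> M \<longrightarrow> finite F \<longrightarrow> S \<inter> \<Inter>F \<noteq> {})"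

lemma fip_Union_chain:
  assumes chain: "subset.chain UNIV C" and ne: "C \<noteq> {}" and fip: "\<And>M. M \<in> C \<Longrightarrow> fip S M"
  shows "fip S (\<Union>C)"
  unfolding fip_def
proof (intro conjI allI impI)
  show "\<Union>C \<subseteq> Pow S" using fip unfolding fip_def by blast
  fix F assume F: "F \<subseteq> \<Union>C" "finite F"
  obtain M where "M \<in> C" "F \<subseteq> M"
    using finite_subset_Union_chain[OF F(2,1) ne chain] by blast
  then show "S \<inter> \<Inter>F \<noteq> {}" using fip F(2) unfolding fip_def by blast
qed

text \<open>By maximality, a set outside \<open>M\<close> is disjoint from some finite intersection
  of members of \<open>M\<close>. If \<open>A\<close> and \<open>S - A\<close> were both outside,
  joining the two finite families would give an empty intersection.\<close>

lemma fip_maximal_ultrafilter: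
  assumes fip: "fip S M" and max: "\<And>N. fip S N \<Longrightarrow> M \<subseteq> N \<Longrightarrow> N = M"
  shows "ultrafilter_on S M"
proof -
  have ne: "S \<inter> \<Inter>F \<noteq> {}" if "F \<subseteq> M" "finite F" for F
    using fip that unfolding fip_def by blast
  have sub: "M \<subseteq> Pow S" using fip unfolding fip_def by blast
  have wit: "\<exists>F\<subseteq>M. finite F \<and> S \<inter> \<Inter>F \<inter> A = {}" if A: "A \<subseteq> S" "A \<notin> M" for A
  proof -
    have "\<not> fip S (insert A M)" using max[of "insert A M"] A(2) by blast
    then obtain F where F: "F \<subseteq> insert A M" "finite F" "S \<inter> \<Inter>F = {}"
      unfolding fip_def using sub A(1) by blast
    have "F - {A} \<subseteq> M" "finite (F - {A})" "S \<inter> \<Inter>(F - {A}) \<inter> A = {}"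
      using F by auto
    then show ?thesis by blast
  qed
  have compl: "S - A \<in> M" if A: "A \<subseteq> S" "A \<notin> M" for A
  proof (rule ccontr)
    assume "S - A \<notin> M"
    then obtain F where F: "F \<subseteq> M" "finite F" "S \<inter> \<Inter>F \<inter> (S - A) = {}"
      using wit[of "S - A"] by blast
    obtain G where G: "G \<subseteq> M" "finite G" "S \<inter> \<Inter>G \<inter> A = {}"
      using wit[OF A] by blast
    have "S \<inter> \<Inter>(F \<union> G) = {}" using F(3) G(3) by blast
    then show False using ne[of "F \<union> G"] F G by blast
  qed
  have empty: "{} \<notin> M" using ne[of "{{}}"] by auto
  have up: "B \<in> M" if "A \<in> M" "A \<subseteq> B" "B \<subseteq> S" for A B
  proof (rule ccontr)
    assume "B \<notin> M"
    then show False using compl[of B] ne[of "{A, S - B}"] that by auto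
  qed
  have int: "A \<inter> B \<in> M" if "A \<in> M" "B \<in> M" for A B
  proof (rule ccontr)
    assume "A \<inter> B \<notin> M"
    moreover have "A \<inter> B \<subseteq> S" using that sub by blast
    ultimately show False using compl[of "A \<inter> B"] ne[of "{A, B, S - A \<inter> B}"] that by auto
  qed
  have "S \<in> M" using compl[of S] empty by auto
  then show ?thesis unfolding ultrafilter_on_def using sub empty up int compl by blast
qed

lemma fip_imp_ultrafilter:
  assumes fip: "fip S M"
  obtains p where "p \<in> beta S" "M \<subseteq> p"
proof -
  let ?A = "{N. fip S N \<and> M \<subseteq> N}"
  have "\<exists>N\<in>?A. \<forall>X\<in>?A. N \<subseteq> X \<longrightarrow> X = N"
  proof (rule subset_Zorn_nonempty)
    show "?A \<noteq> {}" using fip by blast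
    fix C assume C: "C \<noteq> {}" "subset.chain ?A C"
    then have "subset.chain UNIV C" "C \<subseteq> ?A"
      by (auto simp: subset.chain_def)
    then show "\<Union>C \<in> ?A" using fip_Union_chain[of C S] C(1) by blast
  qed
  then obtain N where N: "N \<in> ?A" "\<forall>X\<in>?A. N \<subseteq> X \<longrightarrow> X = N" by (elim bexE)
  then have "ultrafilter_on S N" by (intro fip_maximal_ultrafilter) auto
  then show ?thesis using that[of N] N(1) by (simp add: beta_def)
qed

section \<open>Closed sets of ultrafilters\<close>

text \<open>Closed subsets of \<open>\<beta>S\<close> correspond to filters: \<open>\<Inter>X\<close> is the filter of the closure of \<open>X\<close>.\<close>

definition beta_closed :: "'a set \<Rightarrow> 'a set set set \<Rightarrow> bool" where
  "beta_closed S X \<longleftrightarrow> X \<subseteq> beta S \<and> (\<forall>r\<in>beta S. \<Inter>X \<subseteq> r \<longrightarrow> r \<in> X)"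

lemma beta_ultrafilter: "p \<in> beta S \<Longrightarrow> ultrafilter_on S p"
  by (simp add: beta_def)

lemma Inter_beta_finite_Inter:
  assumes X: "X \<subseteq> beta S" "X \<noteq> {}" and F: "finite F" "F \<subseteq> \<Inter>X"
  shows "S \<inter> \<Inter>F \<in> \<Inter>X"
  using F
proof (induction F)
  case empty
  then show ?case using X(1) ultrafilter_on_univ beta_ultrafilter by fastforce
next
  case (insert A F)
  have "A \<inter> (S \<inter> \<Inter>F) \<in> p" if p: "p \<in> X" for p
  proof (rule ultrafilter_on_Int)
    show "ultrafilter_on S p" using p X(1) beta_ultrafilter by auto
    show "A \<in> p" "S \<inter> \<Inter>F \<in> p" using insert.prems insert.IH p by auto
  qed
  moreover have "S \<inter> \<Inter>(insert A F) = A \<inter> (S \<inter> \<Inter>F)" by auto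
  ultimately show ?case by simp
qed

lemma Inter_beta_props:
  assumes X: "X \<subseteq> beta S" "X \<noteq> {}"
  shows "\<Inter>X \<subseteq> Pow S" "{} \<notin> \<Inter>X"
proof -
  obtain p where p: "p \<in> X" "ultrafilter_on S p" using X beta_ultrafilter by auto
  then show "\<Inter>X \<subseteq> Pow S" "{} \<notin> \<Inter>X"
    using ultrafilter_on_subset[OF p(2)] ultrafilter_on_empty[OF p(2)] by auto
qed

lemma beta_closed_beta: "beta_closed S (beta S)"
  by (simp add: beta_closed_def)

lemma beta_closed_Inter:
  assumes "C \<noteq> {}" "\<And>X. X \<in> C \<Longrightarrow> beta_closed S X"
  shows "beta_closed S (\<Inter>C)"
  unfolding beta_closed_def
proof (intro conjI ballI impI InterI)
  show "\<Inter>C \<subseteq> beta S" using assms unfolding beta_closed_def by blast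
  fix r X assume r: "r \<in> beta S" "\<Inter>(\<Inter>C) \<subseteq> r" and X: "X \<in> C"
  have "\<Inter>X \<subseteq> r" using r(2) X by blast
  then show "r \<in> X" using assms(2)[OF X] r(1) unfolding beta_closed_def by blast
qed

text \<open>Compactness of the space of ultrafilters: as the closed sets shrink, their filters
  \<open>\<Inter>X\<close> grow, so the union of the filters keeps the finite intersection property.
  An ultrafilter above it lies in every closed set of the chain.\<close>

lemma beta_closed_chain_nonempty:
  assumes chain: "subset.chain UNIV C" and ne: "C \<noteq> {}"
    and cl: "\<And>X. X \<in> C \<Longrightarrow> beta_closed S X \<and> X \<noteq> {}"
  shows "\<Inter>C \<noteq> {}"
proof -
  have sub: "X \<subseteq> beta S" "X \<noteq> {}" if "X \<in> C" for X
    using cl[OF that] unfolding beta_closed_def by auto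
  have "subset.chain UNIV (Inter ` C)"
    using chain Inter_anti_mono unfolding subset_chain_def by blast
  moreover have "fip S (\<Inter>X)" if X: "X \<in> C" for X
    unfolding fip_def
    using Inter_beta_props[OF sub[OF X]] Inter_beta_finite_Inter[OF sub[OF X]] by metis
  ultimately have "fip S (\<Union>(Inter ` C))"
    using ne by (intro fip_Union_chain) auto
  then obtain p where p: "p \<in> beta S" "\<Union>(Inter ` C) \<subseteq> p"
    by (rule fip_imp_ultrafilter)
  have "p \<in> X" if "X \<in> C" for X
    using cl[OF that] p that unfolding beta_closed_def by blast
  then show ?thesis by blast
qed

text \<open>Zorn's lemma applied to complements, which turns maximal into minimal. \<open>Q\<close>
  will stand for being closed under the operation, or for being a left ideal.\<close>

lemma beta_closed_minimal:
  assumes X: "beta_closed S X" "X \<noteq> {}" "Q X"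
    and Q: "\<And>C. C \<noteq> {} \<Longrightarrow> (\<And>Y. Y \<in> C \<Longrightarrow> Q Y) \<Longrightarrow> Q (\<Inter>C)"
  obtains Y where "beta_closed S Y" "Y \<noteq> {}" "Q Y" "Y \<subseteq> X"
    "\<forall>Z. beta_closed S Z \<and> Z \<noteq> {} \<and> Q Z \<and> Z \<subseteq> Y \<longrightarrow> Z = Y"
proof -
  let ?A = "{Y. beta_closed S Y \<and> Y \<noteq> {} \<and> Q Y \<and> Y \<subseteq> X}"
  have "\<exists>m\<in>uminus ` ?A. \<forall>Z\<in>uminus ` ?A. m \<subseteq> Z \<longrightarrow> Z = m"
  proof (rule subset_Zorn_nonempty)
    show "uminus ` ?A \<noteq> {}" using X by blast
    fix C assume C: "C \<noteq> {}" "subset.chain (uminus ` ?A) C"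
    define D where "D = uminus ` C"
    have D: "D \<noteq> {}" "D \<subseteq> ?A" using C by (auto simp: subset_chain_def D_def)
    have "subset.chain UNIV D" using C(2) by (auto simp: subset_chain_def D_def)
    then have "\<Inter>D \<noteq> {}" using D by (intro beta_closed_chain_nonempty[of _ S]) auto
    moreover have "beta_closed S (\<Inter>D)" using D by (intro beta_closed_Inter) auto
    moreover have "Q (\<Inter>D)" using D by (intro Q) auto
    moreover have "\<Inter>D \<subseteq> X" using D by blast
    ultimately have "\<Inter>D \<in> ?A" by blast
    moreover have "\<Union>C = - \<Inter>D" by (auto simp: D_def)
    ultimately show "\<Union>C \<in> uminus ` ?A" by blast
  qed
  then obtain m where m: "m \<in> uminus ` ?A" "\<forall>Z\<in>uminus ` ?A. m \<subseteq> Z \<longrightarrow> Z = m" by (elim bexE)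
  from m(1) obtain Y where Y: "m = - Y" "Y \<in> ?A" by (elim imageE)
  show ?thesis
  proof (rule that[of Y]; (intro allI impI; elim conjE)?)
    fix Z assume Z: "beta_closed S Z" "Z \<noteq> {}" "Q Z" "Z \<subseteq> Y"
    then have "- Z \<in> uminus ` ?A" using Y(2) by (intro imageI) auto
    moreover have "m \<subseteq> - Z" using Z(4) Y(1) by simp
    ultimately have "- Z = m" by (rule m(2)[rule_format])
    then show "Z = Y" using Y(1) by simp
  qed (use Y in auto)
qed

section \<open>The semigroup of ultrafilters\<close>

locale add_subsemigroup =
  fixes S :: "'a::semigroup_add set"
  assumes add_mem: "x \<in> S \<Longrightarrow> y \<in> S \<Longrightarrow> x + y \<in> S"
    and nonempty: "S \<noteq> {}"
begin

abbreviation bplus (infixl "\<oplus>" 65) where "p \<oplus> q \<equiv> beta_add S p q"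

lemma mem_bplus: "A \<in> p \<oplus> q \<longleftrightarrow> A \<subseteq> S \<and> {s \<in> S. {t \<in> S. s + t \<in> A} \<in> q} \<in> p"
  by (simp add: beta_add_def)

text \<open>As \<open>q\<close> is an ultrafilter, sending \<open>A\<close> to
  \<open>{s \<in> S. {t \<in> S. s + t \<in> A} \<in> q}\<close> respects intersections, inclusions
  and complements, so the axioms pull back from \<open>p\<close>.\<close>

lemma bplus_beta:
  assumes p: "p \<in> beta S" and q: "q \<in> beta S"
  shows "p \<oplus> q \<in> beta S"
proof -
  note up = beta_ultrafilter[OF p] and uq = beta_ultrafilter[OF q]
  have univ: "S \<in> p \<oplus> q"
    using ultrafilter_on_univ[OF up] ultrafilter_on_univ[OF uq]
    by (simp add: mem_bplus add_mem cong: conj_cong)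
  have empty: "{} \<notin> p \<oplus> q"
    using ultrafilter_on_empty[OF up] ultrafilter_on_empty[OF uq] by (simp add: mem_bplus)
  have int: "A \<inter> B \<in> p \<oplus> q" if "A \<in> p \<oplus> q" "B \<in> p \<oplus> q" for A B
  proof -
    have eq: "{t \<in> S. s + t \<in> A \<inter> B} = {t \<in> S. s + t \<in> A} \<inter> {t \<in> S. s + t \<in> B}" for s
      by auto
    have "{s \<in> S. {t \<in> S. s + t \<in> A \<inter> B} \<in> q}
        = {s \<in> S. {t \<in> S. s + t \<in> A} \<in> q} \<inter> {s \<in> S. {t \<in> S. s + t \<in> B} \<in> q}"
      unfolding eq by (subst ultrafilter_on_Int_iff[OF uq]) auto
    then show ?thesis using that ultrafilter_on_Int[OF up] unfolding mem_bplus by auto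
  qed
  have up': "B \<in> p \<oplus> q" if A: "A \<in> p \<oplus> q" and B: "A \<subseteq> B" "B \<subseteq> S" for A B
  proof -
    have "{t \<in> S. s + t \<in> B} \<in> q" if "{t \<in> S. s + t \<in> A} \<in> q" for s
      by (rule ultrafilter_on_mono[OF uq that]) (use B in auto)
    then have "{s \<in> S. {t \<in> S. s + t \<in> A} \<in> q} \<subseteq> {s \<in> S. {t \<in> S. s + t \<in> B} \<in> q}" by blast
    then show ?thesis using A B(2) ultrafilter_on_mono[OF up] unfolding mem_bplus by auto
  qed
  have compl: "A \<in> p \<oplus> q \<or> S - A \<in> p \<oplus> q" if A: "A \<subseteq> S" for A
  proof -
    have "{t \<in> S. s + t \<in> S - A} = S - {t \<in> S. s + t \<in> A}" if "s \<in> S" for s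
      using that add_mem by auto
    then have "{t \<in> S. s + t \<in> S - A} \<in> q \<longleftrightarrow> {t \<in> S. s + t \<in> A} \<notin> q" if "s \<in> S" for s
      using that ultrafilter_on_compl_iff[OF uq, of "{t \<in> S. s + t \<in> A}"] by auto
    then have "{s \<in> S. {t \<in> S. s + t \<in> S - A} \<in> q} = S - {s \<in> S. {t \<in> S. s + t \<in> A} \<in> q}"
      by blast
    then show ?thesis
      using ultrafilter_on_compl[OF up, of "{s \<in> S. {t \<in> S. s + t \<in> A} \<in> q}"] A
      unfolding mem_bplus by auto
  qed
  have sub: "p \<oplus> q \<subseteq> Pow S" by (auto simp: mem_bplus)
  show ?thesis unfolding beta_def ultrafilter_on_def mem_Collect_eq
    by (intro conjI ballI allI impI; (elim conjE)?)
      (fact sub univ empty | erule (1) int | erule (2) up' | erule compl)+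
qed

lemma bplus_assoc: "(p \<oplus> q) \<oplus> r = p \<oplus> (q \<oplus> r)"
proof (rule set_eqI)
  fix A
  have 1: "{t \<in> S. s + t \<in> {u \<in> S. {v \<in> S. u + v \<in> A} \<in> r}}
     = {t \<in> S. {v \<in> S. t + v \<in> {w \<in> S. s + w \<in> A}} \<in> r}" if s: "s \<in> S" for s
  proof -
    have "{v \<in> S. t + v \<in> {w \<in> S. s + w \<in> A}} = {v \<in> S. s + t + v \<in> A}" if "t \<in> S" for t
      using that add_mem by (auto simp: add.assoc)
    then show ?thesis using s add_mem by auto
  qed
  show "A \<in> (p \<oplus> q) \<oplus> r \<longleftrightarrow> A \<in> p \<oplus> (q \<oplus> r)"
    unfolding mem_bplus using 1 by (simp cong: conj_cong)
qed

text \<open>Right translations are continuous, so they map compact sets to compact, hence closed, sets.\<close>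

lemma beta_closed_translate:
  assumes X: "beta_closed S X" "X \<noteq> {}" and q: "q \<in> beta S"
  shows "beta_closed S ((\<lambda>p. p \<oplus> q) ` X)"
  unfolding beta_closed_def
proof (intro conjI ballI impI)
  have Xb: "X \<subseteq> beta S" using X(1) unfolding beta_closed_def by blast
  show "(\<lambda>p. p \<oplus> q) ` X \<subseteq> beta S" using Xb bplus_beta q by blast
  fix r assume r: "r \<in> beta S" "\<Inter> ((\<lambda>p. p \<oplus> q) ` X) \<subseteq> r"
  \<comment> \<open>For \<open>A \<subseteq> S\<close>, \<open>T A \<in> p\<close> means
    \<open>A \<in> p \<oplus> q\<close>. So an ultrafilter \<open>p\<close> containing
    \<open>\<Inter>X\<close> and every \<open>T A\<close> with \<open>A \<in> r\<close> lies in
    \<open>X\<close> and satisfies \<open>r = p \<oplus> q\<close>. It exists once this family has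
    the finite intersection property.\<close>
  define T where "T A = {s \<in> S. {t \<in> S. s + t \<in> A} \<in> q}" for A
  have T_Int: "T A \<inter> T B = T (A \<inter> B)" for A B
  proof -
    have "{t \<in> S. s + t \<in> A \<inter> B} = {t \<in> S. s + t \<in> A} \<inter> {t \<in> S. s + t \<in> B}" for s by auto
    then show ?thesis
      unfolding T_def using ultrafilter_on_Int_iff[OF beta_ultrafilter[OF q]] by auto
  qed
  \<comment> \<open>If \<open>G\<close> missed \<open>T A\<close>, then \<open>S - A\<close> would
    belong to \<open>p \<oplus> q\<close> for every \<open>p \<in> X\<close>, hence to
    \<open>r\<close>.\<close>
  have meet: "G \<inter> T A \<noteq> {}" if G: "G \<in> \<Inter>X" and A: "A \<in> r" for G A
  proof
    assume GT: "G \<inter> T A = {}"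
    have "S - A \<in> p \<oplus> q" if p: "p \<in> X" for p
    proof -
      have pb: "p \<in> beta S" using p Xb by blast
      have "T A \<notin> p"
        using GT G p ultrafilter_on_Int[OF beta_ultrafilter[OF pb], of G "T A"]
          ultrafilter_on_empty[OF beta_ultrafilter[OF pb]] by auto
      then have "A \<notin> p \<oplus> q" unfolding mem_bplus T_def by blast
      then show ?thesis
        using ultrafilter_on_compl[OF beta_ultrafilter[OF bplus_beta[OF pb q]]]
          ultrafilter_on_subset[OF beta_ultrafilter[OF r(1)] A] by blast
    qed
    then have "S - A \<in> r" using r(2) by blast
    then show False
      using ultrafilter_on_compl_iff[OF beta_ultrafilter[OF r(1)]] A
        ultrafilter_on_subset[OF beta_ultrafilter[OF r(1)] A] by blast
  qed
  have T_Inter: "\<exists>A\<in>r. T A \<subseteq> S \<inter> \<Inter>F" if "finite F" "F \<subseteq> T ` r" for F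
    using that
  proof (induction F)
    case empty
    have "S \<in> r" using r(1) ultrafilter_on_univ beta_ultrafilter by blast
    then show ?case by (auto simp: T_def)
  next
    case (insert B F)
    then obtain A A' where "A \<in> r" "T A \<subseteq> S \<inter> \<Inter>F" "A' \<in> r" "B = T A'" by blast
    then have "A' \<inter> A \<in> r" "T (A' \<inter> A) \<subseteq> S \<inter> \<Inter>(insert B F)"
      using ultrafilter_on_Int[OF beta_ultrafilter[OF r(1)]] T_Int[of A' A, symmetric] by auto
    then show ?case by blast
  qed
  have "fip S (\<Inter>X \<union> T ` r)"
    unfolding fip_def
  proof (intro conjI allI impI)
    show "\<Inter>X \<union> T ` r \<subseteq> Pow S"
      using Inter_beta_props(1)[OF Xb X(2)] by (auto simp: T_def)
    fix F assume F: "F \<subseteq> \<Inter>X \<union> T ` r" "finite F"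
    let ?F = "F \<inter> \<Inter>X" and ?G = "F \<inter> T ` r"
    have "S \<inter> \<Inter>?F \<in> \<Inter>X" using Inter_beta_finite_Inter[OF Xb X(2)] F(2) by auto
    moreover obtain A where "A \<in> r" "T A \<subseteq> S \<inter> \<Inter>?G" using T_Inter[of ?G] F(2) by auto
    ultimately have ne: "(S \<inter> \<Inter>?F) \<inter> (S \<inter> \<Inter>?G) \<noteq> {}" using meet by blast
    have "F = ?F \<union> ?G" using F(1) by blast
    then have "\<Inter>F = \<Inter>?F \<inter> \<Inter>?G" by (metis Inter_Un_distrib)
    then have "S \<inter> \<Inter>F = (S \<inter> \<Inter>?F) \<inter> (S \<inter> \<Inter>?G)" by (simp only: Int_ac Int_left_absorb)
    then show "S \<inter> \<Inter>F \<noteq> {}" using ne by (simp only: not_False_eq_True)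
  qed
  then obtain p where p: "p \<in> beta S" "\<Inter>X \<union> T ` r \<subseteq> p" by (rule fip_imp_ultrafilter)
  have pX: "p \<in> X" using p X(1) unfolding beta_closed_def by blast
  have "r \<subseteq> p \<oplus> q"
  proof
    fix A assume A: "A \<in> r"
    then have "T A \<in> p" using p(2) by blast
    then show "A \<in> p \<oplus> q"
      using ultrafilter_on_subset[OF beta_ultrafilter[OF r(1)] A] unfolding mem_bplus T_def by blast
  qed
  then have "r = p \<oplus> q"
    using ultrafilter_on_subset_eq[OF beta_ultrafilter[OF r(1)] beta_ultrafilter[OF bplus_beta[OF p(1) q]]]
    by blast
  then show "r \<in> (\<lambda>p. p \<oplus> q) ` X" using pX by blast
qed

text \<open>The equation \<open>y \<oplus> x = x\<close> forces into \<open>y\<close> certain sets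
  that depend on \<open>x\<close> only. Their membership passes to the closure and, by maximality of
  ultrafilters, gives the equation back.\<close>

lemma beta_closed_stabilizer:
  assumes T: "beta_closed S T" and x: "x \<in> beta S"
  shows "beta_closed S {y \<in> T. y \<oplus> x = x}"
  unfolding beta_closed_def
proof (intro conjI ballI impI)
  show "{y \<in> T. y \<oplus> x = x} \<subseteq> beta S" using T unfolding beta_closed_def by blast
  fix r assume r: "r \<in> beta S" "\<Inter> {y \<in> T. y \<oplus> x = x} \<subseteq> r"
  have "\<Inter>T \<subseteq> r" using r(2) by blast
  then have "r \<in> T" using T r(1) unfolding beta_closed_def by blast
  have "x \<subseteq> r \<oplus> x"
  proof
    fix A assume A: "A \<in> x"
    have "{s \<in> S. {t \<in> S. s + t \<in> A} \<in> x} \<in> y" if "y \<oplus> x = x" for y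
      using A that mem_bplus[of A y x] by simp
    then have "{s \<in> S. {t \<in> S. s + t \<in> A} \<in> x} \<in> r" using r(2) by blast
    then show "A \<in> r \<oplus> x"
      using ultrafilter_on_subset[OF beta_ultrafilter[OF x] A] unfolding mem_bplus by blast
  qed
  then have "r \<oplus> x = x"
    using ultrafilter_on_subset_eq[OF beta_ultrafilter[OF x] beta_ultrafilter[OF bplus_beta[OF r(1) x]]]
    by blast
  then show "r \<in> {y \<in> T. y \<oplus> x = x}" using \<open>r \<in> T\<close> by blast
qed

text \<open>Take \<open>x\<close> in a minimal closed subsemigroup \<open>T\<close> of
  \<open>L\<close>. By minimality \<open>T \<oplus> x\<close> is all of \<open>T\<close>, so some
  \<open>y \<in> T\<close> has \<open>y \<oplus> x = x\<close>. The set of these \<open>y\<close> is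
  again a closed subsemigroup, so it is \<open>T\<close> and contains \<open>x\<close>
  itself.\<close>

theorem Ellis_idempotent:
  assumes L: "beta_closed S L" "L \<noteq> {}" "\<And>x y. x \<in> L \<Longrightarrow> y \<in> L \<Longrightarrow> x \<oplus> y \<in> L"
  obtains x where "x \<in> L" "x \<oplus> x = x"
proof -
  define Q where "Q X \<longleftrightarrow> (\<forall>x\<in>X. \<forall>y\<in>X. x \<oplus> y \<in> X)" for X
  have QL: "Q L" using L(3) unfolding Q_def by simp
  have Q_Inter: "Q (\<Inter>C)" if "\<And>Y. Y \<in> C \<Longrightarrow> Q Y" for C
    using that unfolding Q_def by simp
  obtain T where T: "beta_closed S T" "T \<noteq> {}" "Q T" "T \<subseteq> L"
    and min: "\<forall>Z. beta_closed S Z \<and> Z \<noteq> {} \<and> Q Z \<and> Z \<subseteq> T \<longrightarrow> Z = T"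
    by (rule beta_closed_minimal[of S L Q, OF L(1,2) QL Q_Inter])
  obtain x where x: "x \<in> T" using T(2) by blast
  have xb: "x \<in> beta S" using x T(1) unfolding beta_closed_def by blast
  have "(\<lambda>p. p \<oplus> x) ` T = T"
  proof (intro min[rule_format] conjI)
    show "beta_closed S ((\<lambda>p. p \<oplus> x) ` T)" using beta_closed_translate T(1,2) xb by blast
    show "Q ((\<lambda>p. p \<oplus> x) ` T)"
      using T(3) x unfolding Q_def by (simp add: bplus_assoc[symmetric])
    show "(\<lambda>p. p \<oplus> x) ` T \<subseteq> T"
      using T(3) x unfolding Q_def by (intro image_subsetI) simp
  qed (use x in blast)
  then have "x \<in> (\<lambda>p. p \<oplus> x) ` T" using x by simp
  then obtain y where "x = y \<oplus> x" "y \<in> T" by (elim imageE)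
  then have ne: "{y \<in> T. y \<oplus> x = x} \<noteq> {}" by auto
  have "{y \<in> T. y \<oplus> x = x} = T"
  proof (intro min[rule_format] conjI)
    show "beta_closed S {y \<in> T. y \<oplus> x = x}" using beta_closed_stabilizer T(1) xb by blast
    show "Q {y \<in> T. y \<oplus> x = x}"
      using T(3) unfolding Q_def by (simp add: bplus_assoc)
  qed (use ne in auto)
  then have "x \<oplus> x = x" using x by blast
  then show ?thesis using that x T(4) by blast
qed

section \<open>Minimal left ideals and the existence of a minimal idempotent\<close>

lemma beta_nonempty: "beta S \<noteq> {}"
proof -
  have "fip S {}" using nonempty by (simp add: fip_def)
  then show ?thesis using fip_imp_ultrafilter by blast
qed

text \<open>A minimal closed left ideal \<open>L\<close> lies in every two-sided ideal, so the
  intersection of these ideals is nonempty and is the smallest one. Ellis' theorem supplies an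
  idempotent in \<open>L\<close>.\<close>

theorem minimal_idempotent_exists:
  obtains q where "minimal_idempotent S q"
proof -
  define Q where "Q X \<longleftrightarrow> (\<forall>x\<in>X. \<forall>p\<in>beta S. p \<oplus> x \<in> X)" for X
  have Q_beta: "Q (beta S)" using bplus_beta unfolding Q_def by simp
  have Q_Inter: "Q (\<Inter>C)" if "\<And>Y. Y \<in> C \<Longrightarrow> Q Y" for C
    using that unfolding Q_def by simp
  obtain L where L: "beta_closed S L" "L \<noteq> {}" "Q L" "L \<subseteq> beta S"
    and min: "\<forall>Z. beta_closed S Z \<and> Z \<noteq> {} \<and> Q Z \<and> Z \<subseteq> L \<longrightarrow> Z = L"
    by (rule beta_closed_minimal[of S "beta S" Q, OF beta_closed_beta beta_nonempty Q_beta Q_Inter])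
  have L_left: "p \<oplus> x \<in> L" if "x \<in> L" "p \<in> beta S" for x p
    using L(3) that unfolding Q_def by simp
  have LI: "L \<subseteq> I" if I: "two_sided_ideal S I" for I
  proof -
    obtain i l where il: "i \<in> I" "l \<in> L" using I L(2) unfolding two_sided_ideal_def by blast
    have ib: "i \<in> beta S" and lb: "l \<in> beta S"
      using il L(4) I unfolding two_sided_ideal_def by blast+
    have z: "i \<oplus> l \<in> I" "i \<oplus> l \<in> L" "i \<oplus> l \<in> beta S"
      using I il ib lb L_left bplus_beta unfolding two_sided_ideal_def by blast+
    \<comment> \<open>\<open>i \<oplus> l\<close> lies in both \<open>I\<close> and
      \<open>L\<close>, and so do all its left multiples. They form a closed left ideal, which
      minimality makes all of \<open>L\<close>.\<close>
    have "(\<lambda>p. p \<oplus> (i \<oplus> l)) ` beta S = L"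
    proof (intro min[rule_format] conjI)
      show "beta_closed S ((\<lambda>p. p \<oplus> (i \<oplus> l)) ` beta S)"
        using beta_closed_translate beta_closed_beta beta_nonempty z(3) by blast
      show "Q ((\<lambda>p. p \<oplus> (i \<oplus> l)) ` beta S)"
        using bplus_beta unfolding Q_def by (auto simp: bplus_assoc[of _ _ "i \<oplus> l", symmetric])
      show "(\<lambda>p. p \<oplus> (i \<oplus> l)) ` beta S \<subseteq> L" using L_left z(2) by blast
    qed (use beta_nonempty in blast)
    moreover have "(\<lambda>p. p \<oplus> (i \<oplus> l)) ` beta S \<subseteq> I"
      using I z(1) unfolding two_sided_ideal_def by blast
    ultimately show ?thesis by simp
  qed
  define K where "K = \<Inter> {I. two_sided_ideal S I}"
  have LK: "L \<subseteq> K" using LI unfolding K_def by blast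
  have beta_ideal: "two_sided_ideal S (beta S)"
    using bplus_beta beta_nonempty unfolding two_sided_ideal_def by blast
  have "two_sided_ideal S K"
    unfolding two_sided_ideal_def
  proof (intro conjI ballI)
    show "K \<noteq> {}" using LK L(2) by blast
    show "K \<subseteq> beta S" using beta_ideal unfolding K_def by blast
    show "p \<oplus> q \<in> K" "q \<oplus> p \<in> K" if "p \<in> K" "q \<in> beta S" for p q
      using that unfolding K_def two_sided_ideal_def by blast+
  qed
  then have K: "smallest_ideal S K" unfolding smallest_ideal_def K_def by blast
  have "\<And>x y. x \<in> L \<Longrightarrow> y \<in> L \<Longrightarrow> x \<oplus> y \<in> L" using L_left L(4) by blast
  then obtain q where "q \<in> L" "q \<oplus> q = q"
    using Ellis_idempotent[OF L(1,2)] by blast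
  then have "minimal_idempotent S q" unfolding minimal_idempotent_def using K LK L(4) by blast
  then show ?thesis using that by blast
qed

lemma idempotent_shifts:
  assumes q: "q \<in> beta S" "q \<oplus> q = q" and A: "A \<in> q"
  shows "{s \<in> S. {t \<in> S. s + t \<in> A} \<in> q} \<in> q"
  using A q(2) mem_bplus[of A q q] by simp

end

section \<open>Finite sums and arithmetic progressions\<close>

interpretation pnat: add_subsemigroup pnat
  by unfold_locales (auto simp: pnat_def)

text \<open>Pick \<open>a \<in> A\<close> such that the shift of \<open>A\<close> by
  \<open>a\<close> is in \<open>q\<close>, and continue inside the intersection of \<open>A\<close>
  with this shift: sums found there stay in \<open>A\<close> whether or not \<open>a\<close> is
  added.\<close>

lemma idempotent_contains_FS:
  assumes q: "q \<in> beta pnat" "beta_add pnat q q = q" and A: "A \<in> q"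
  shows "contains_FS k A"
  using A
proof (induction k arbitrary: A)
  case 0
  then show ?case by (auto simp: contains_FS_def)
next
  case (Suc k)
  note u = beta_ultrafilter[OF q(1)]
  have Ap: "A \<subseteq> pnat" using Suc.prems ultrafilter_on_subset[OF u] by blast
  have "A \<inter> {s \<in> pnat. {t \<in> pnat. s + t \<in> A} \<in> q} \<in> q"
    using pnat.idempotent_shifts[OF q Suc.prems] Suc.prems ultrafilter_on_Int[OF u] by blast
  then obtain a where a: "a \<in> A" "a \<in> pnat" "{t \<in> pnat. a + t \<in> A} \<in> q"
    using ultrafilter_on_empty[OF u] by (metis (no_types, lifting) IntE ex_in_conv mem_Collect_eq)
  then have "A \<inter> {t \<in> pnat. a + t \<in> A} \<in> q" using Suc.prems ultrafilter_on_Int[OF u] by blast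
  from Suc.IH[OF this, unfolded contains_FS_def] obtain f :: "nat \<Rightarrow> nat"
    where f: "\<forall>i\<in>{1..k}. f i \<in> pnat"
      and f_sub: "{\<Sum>i\<in>F. f i | F. F \<noteq> {} \<and> F \<subseteq> {1..k}} \<subseteq> A \<inter> {t \<in> pnat. a + t \<in> A}"
    by (elim exE conjE)
  have fs: "sum f F \<in> A" "a + sum f F \<in> A" if "F \<noteq> {}" "F \<subseteq> {1..k}" for F
  proof -
    have "sum f F \<in> A \<inter> {t \<in> pnat. a + t \<in> A}" by (rule subsetD[OF f_sub]) (use that in auto)
    then show "sum f F \<in> A" "a + sum f F \<in> A" by auto
  qed
  let ?g = "f(Suc k := a)"
  have "sum ?g F \<in> A" if F: "F \<noteq> {}" "F \<subseteq> {1..Suc k}" for F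
  proof -
    have sub: "F - {Suc k} \<subseteq> {1..k}" using F(2) by (auto simp: le_Suc_eq)
    have fin: "finite F" using F(2) finite_subset by blast
    have eq: "sum ?g (F - {Suc k}) = sum f (F - {Suc k})" by (intro sum.cong) auto
    show ?thesis
    proof (cases "Suc k \<in> F")
      case True
      then have "sum ?g F = a + sum f (F - {Suc k})" using eq sum.remove[OF fin True, of ?g] by simp
      \<comment> \<open>For \<open>F = {Suc k}\<close> the sum is \<open>a\<close> alone, which is
        why \<open>a\<close> was taken from \<open>A\<close>.\<close>
      then show ?thesis using fs[of "F - {Suc k}"] sub a(1) by (cases "F - {Suc k} = {}") auto
    next
      case False
      then show ?thesis using fs[of F] sub eq F(1) by auto
    qed
  qed
  moreover have "?g i \<in> pnat" if "i \<in> {1..Suc k}" for i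
    using that f a(2) by (auto simp: le_Suc_eq)
  ultimately show ?case unfolding contains_FS_def by (intro exI[of _ ?g]) blast
qed

section \<open>Arithmetic progressions in members of minimal idempotents\<close>

lemma contains_AP_mono: "contains_AP k A \<Longrightarrow> A \<subseteq> B \<Longrightarrow> contains_AP k B"
  unfolding contains_AP_def by blast

lemma contains_AP_Suc_nonempty: "contains_AP (Suc k) A \<Longrightarrow> A \<noteq> {}"
  unfolding contains_AP_def by auto

lemma contains_AP_shift:
  assumes "contains_AP k {s \<in> pnat. t + s \<in> A}"
  shows "contains_AP k A"
proof -
  from assms obtain a d where ad: "a \<in> pnat" "d \<in> pnat"
    and *: "\<And>i. i < k \<Longrightarrow> t + (a + i * d) \<in> A" unfolding contains_AP_def by blast
  have "t + a \<in> pnat" using ad(1) by (simp add: pnat_def)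
  then show ?thesis unfolding contains_AP_def using ad(2) *
    by (intro bexI[of _ "t + a"] bexI[of _ d]) (auto simp: add.assoc)
qed

text \<open>For \<open>p\<close> in the family, a member \<open>A\<close> of the product of
  \<open>p\<close> and \<open>q\<close> has shifts in \<open>q\<close> along a whole progression; a
  common point of these finitely many shifts translates the progression into \<open>A\<close>. In
  the other order, one shift of \<open>A\<close> in \<open>p\<close> is enough.\<close>

lemma AP_ideal:
  assumes "p \<in> beta pnat" "\<And>A. A \<in> p \<Longrightarrow> contains_AP k A"
  shows "two_sided_ideal pnat {p \<in> beta pnat. \<forall>A\<in>p. contains_AP k A}"
  unfolding two_sided_ideal_def
proof (intro conjI ballI)
  show "{p \<in> beta pnat. \<forall>A\<in>p. contains_AP k A} \<noteq> {}" using assms by blast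
  show "{p \<in> beta pnat. \<forall>A\<in>p. contains_AP k A} \<subseteq> beta pnat" by blast
  fix p q :: "nat set set"
  assume p': "p \<in> {p \<in> beta pnat. \<forall>A\<in>p. contains_AP k A}" and q: "q \<in> beta pnat"
  have p: "p \<in> beta pnat" and AP: "\<And>A. A \<in> p \<Longrightarrow> contains_AP k A" using p' by auto
  note up = beta_ultrafilter[OF p] and uq = beta_ultrafilter[OF q]
  have "contains_AP k A" if "A \<in> beta_add pnat p q" for A
  proof -
    have "{s \<in> pnat. {t \<in> pnat. s + t \<in> A} \<in> q} \<in> p" using that pnat.mem_bplus by blast
    from AP[OF this] obtain a d where ad: "a \<in> pnat" "d \<in> pnat"
      and *: "\<And>i. i < k \<Longrightarrow> {t \<in> pnat. (a + i * d) + t \<in> A} \<in> q"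
      unfolding contains_AP_def by blast
    have "{t \<in> pnat. \<forall>i\<in>{..<k}. (a + i * d) + t \<in> A} \<in> q"
      by (rule ultrafilter_on_Collect_ball[OF uq]) (use * in auto)
    then obtain t where t: "\<forall>i\<in>{..<k}. (a + i * d) + t \<in> A"
      by (rule ultrafilter_on_nonempty[OF uq])
    have "{a + i * d | i. i < k} \<subseteq> {s \<in> pnat. t + s \<in> A}"
      using t ad(1) by (auto simp: pnat_def add.commute)
    then show ?thesis using contains_AP_shift[of k t A] ad unfolding contains_AP_def by blast
  qed
  then show "beta_add pnat p q \<in> {p \<in> beta pnat. \<forall>A\<in>p. contains_AP k A}"
    using pnat.bplus_beta[OF p q] by blast
  have "contains_AP k A" if "A \<in> beta_add pnat q p" for A
  proof -
    have "{s \<in> pnat. {t \<in> pnat. s + t \<in> A} \<in> p} \<in> q" using that pnat.mem_bplus by blast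
    then obtain s where "{t \<in> pnat. s + t \<in> A} \<in> p" by (rule ultrafilter_on_nonempty[OF uq])
    then show ?thesis using AP contains_AP_shift by blast
  qed
  then show "beta_add pnat q p \<in> {p \<in> beta pnat. \<forall>A\<in>p. contains_AP k A}"
    using pnat.bplus_beta[OF q p] by blast
qed

text \<open>
  Colour focusing: for each colour \<open>s \<in> R\<close>, the \<open>k\<close> points \<open>e s + i * d s + t\<close> with \<open>i < k\<close> have
  colour \<open>s\<close> for \<open>q\<close>-many \<open>t\<close>, and all these progressions continue to the common point \<open>x + t\<close>.
\<close>

lemma colour_focusing:
  fixes c :: "nat \<Rightarrow> 'c"
  assumes q: "q \<in> beta pnat" "beta_add pnat q q = q"
    and AP: "\<And>A. A \<in> q \<Longrightarrow> contains_AP k A"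
    and fin: "finite (c ` pnat)"
    and none: "\<And>j. \<not> contains_AP (Suc k) {x \<in> pnat. c x = j}"
  shows "\<exists>R x e d. finite R \<and> R \<subseteq> c ` pnat \<and> card R = n \<and>
    (\<forall>s\<in>R. d s \<in> pnat \<and> e s + k * d s = x \<and>
      (\<forall>i<k. {t \<in> pnat. c (e s + i * d s + t) = s} \<in> q))"
proof (induction n)
  case 0
  show ?case by (intro exI[of _ "{}"]) auto
next
  case (Suc n)
  note u = beta_ultrafilter[OF q(1)]
  from Suc obtain R x e d where R: "finite R" "R \<subseteq> c ` pnat" "card R = n"
    and d: "\<And>s. s \<in> R \<Longrightarrow> d s \<in> pnat" and ed: "\<And>s. s \<in> R \<Longrightarrow> e s + k * d s = x"
    and foc: "\<And>s i. s \<in> R \<Longrightarrow> i < k \<Longrightarrow> {t \<in> pnat. c (e s + i * d s + t) = s} \<in> q"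
    by blast
  have "(\<lambda>t. c (x + t)) ` pnat \<subseteq> c ` pnat" by (auto simp: pnat_def)
  then obtain s where s: "{t \<in> pnat. c (x + t) = s} \<in> q"
    using ultrafilter_on_colour[OF u, of "\<lambda>t. c (x + t)"] fin finite_subset by metis
  have s_ran: "s \<in> c ` pnat"
    using ultrafilter_on_nonempty[OF u s] by (metis imageI pnat_def mem_Collect_eq trans_le_add2)
  \<comment> \<open>\<open>s\<close> is the typical colour of the focus \<open>x + t\<close>. Were
    it in \<open>R\<close>, the focus would be the term of index \<open>k\<close> of the progression
    for \<open>s\<close>, giving \<open>Suc k\<close> terms of one colour.\<close>
  have "s \<notin> R"
  proof
    assume sR: "s \<in> R"
    have "{t \<in> pnat. \<forall>i\<in>{..<Suc k}. c (e s + i * d s + t) = s} \<in> q"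
      by (rule ultrafilter_on_Collect_ball[OF u])
        (use foc[OF sR] s ed[OF sR] in \<open>auto simp: less_Suc_eq\<close>)
    then obtain t where t: "t \<in> pnat" "\<And>i. i < Suc k \<Longrightarrow> c (e s + i * d s + t) = s"
      by (rule ultrafilter_on_nonempty[OF u]) auto
    have "contains_AP (Suc k) {x \<in> pnat. c x = s}"
      unfolding contains_AP_def
      by (intro bexI[of _ "e s + t"] bexI[of _ "d s"])
        (use t d[OF sR] in \<open>auto simp: pnat_def add_ac\<close>)
    then show False using none by blast
  qed
  \<comment> \<open>The \<open>t\<close> that suit the focus and all old progressions at once.
    Idempotence and \<open>AP\<close> give a progression \<open>a + i * b\<close> along which the
    shifts of \<open>?U\<close> stay in \<open>q\<close>.\<close>
  let ?U = "{t \<in> pnat. c (x + t) = s} \<inter>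
    {t \<in> pnat. \<forall>z\<in>R \<times> {..<k}. c (e (fst z) + snd z * d (fst z) + t) = fst z}"
  have "{t \<in> pnat. \<forall>z\<in>R \<times> {..<k}. c (e (fst z) + snd z * d (fst z) + t) = fst z} \<in> q"
    by (rule ultrafilter_on_Collect_ball[OF u]) (use foc R(1) in auto)
  then have "?U \<in> q" using s ultrafilter_on_Int[OF u] by blast
  from AP[OF pnat.idempotent_shifts[OF q this]] obtain a b where ab: "a \<in> pnat" "b \<in> pnat"
    and U: "\<And>i. i < k \<Longrightarrow> {t \<in> pnat. (a + i * b) + t \<in> ?U} \<in> q"
    unfolding contains_AP_def by blast
  \<comment> \<open>The new progression, of colour \<open>s\<close>, starts from the old focus:
    \<open>x + a + i * b\<close>. In the old ones the term of index \<open>i\<close> moves by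
    \<open>a + i * b\<close>. All of them meet at the new focus
    \<open>x + a + k * b\<close>.\<close>
  let ?e = "\<lambda>r. if r = s then x + a else e r + a"
  let ?d = "\<lambda>r. if r = s then b else d r + b"
  have foc': "{t \<in> pnat. c (?e r + i * ?d r + t) = r} \<in> q" if r: "r \<in> insert s R" and i: "i < k" for r i
  proof (rule ultrafilter_on_mono[OF u U[OF i]])
    show "{t \<in> pnat. (a + i * b) + t \<in> ?U} \<subseteq> {t \<in> pnat. c (?e r + i * ?d r + t) = r}"
    proof
      fix t assume t: "t \<in> {t \<in> pnat. (a + i * b) + t \<in> ?U}"
      show "t \<in> {t \<in> pnat. c (?e r + i * ?d r + t) = r}"
      proof (cases "r = s")
        case True
        have "c (x + ((a + i * b) + t)) = s" using t by blast
        then show ?thesis using t True by (simp add: add_ac)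
      next
        case False
        then have "(r, i) \<in> R \<times> {..<k}" using r i by simp
        then have "c (e r + i * d r + ((a + i * b) + t)) = r" using t by fastforce
        then show ?thesis using t False by (simp add: algebra_simps)
      qed
    qed
  qed auto
  have ed': "?d r \<in> pnat" "?e r + k * ?d r = x + a + k * b" if "r \<in> insert s R" for r
    using that ab ed[of r] by (auto simp: pnat_def algebra_simps)
  have R': "finite (insert s R)" "insert s R \<subseteq> c ` pnat" "card (insert s R) = Suc n"
    using R s_ran \<open>s \<notin> R\<close> by auto
  show ?case
    by (intro exI[of _ "insert s R"] exI[of _ "x + a + k * b"] exI[of _ ?e] exI[of _ ?d]
        conjI ballI allI impI; (rule R' ed' foc'; assumption)?)
qed

text \<open>Otherwise focusing would produce one colour more than there are.\<close>

lemma colouring_contains_AP_Suc: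
  assumes q: "q \<in> beta pnat" "beta_add pnat q q = q"
    and AP: "\<And>A. A \<in> q \<Longrightarrow> contains_AP k A"
    and fin: "finite (c ` pnat)"
  obtains j where "contains_AP (Suc k) {x \<in> pnat. c x = j}"
proof (rule ccontr)
  assume "\<not> thesis"
  then have "\<And>j. \<not> contains_AP (Suc k) {x \<in> pnat. c x = j}" using that by blast
  from colour_focusing[OF q AP fin this, of "Suc (card (c ` pnat))"]
  obtain R where "R \<subseteq> c ` pnat" "card R = Suc (card (c ` pnat))" by blast
  then show False using card_mono[OF fin, of R] by simp
qed

theorem minimal_idempotent_contains_AP:
  assumes q: "minimal_idempotent pnat q" and A: "A \<in> q"
  shows "contains_AP k A"
  using A
proof (induction k arbitrary: A)
  case 0
  show ?case unfolding contains_AP_def by (auto simp: pnat_def)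
next
  case (Suc k)
  from q obtain K where qb: "q \<in> beta pnat" "beta_add pnat q q = q"
    and K: "smallest_ideal pnat K" "q \<in> K" unfolding minimal_idempotent_def by blast
  \<comment> \<open>An ultrafilter containing \<open>?M\<close> has no member free of progressions
    with \<open>Suc k\<close> terms, so it makes \<open>AP_ideal\<close> applicable.\<close>
  let ?M = "{pnat - N | N. N \<subseteq> pnat \<and> \<not> contains_AP (Suc k) N}"
  have "fip pnat ?M"
    unfolding fip_def
  proof (intro conjI allI impI notI)
    show "?M \<subseteq> Pow pnat" by blast
    fix F assume F: "F \<subseteq> ?M" "finite F" "pnat \<inter> \<Inter>F = {}"
    \<comment> \<open>As \<open>F\<close> has empty intersection, each point can be coloured by a
      member of \<open>F\<close> that misses it. A colour class then lies in some \<open>N\<close>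
      without progressions of \<open>Suc k\<close> terms, while the colouring is finite.\<close>
    define c where "c x = (SOME X. X \<in> F \<and> x \<notin> X)" for x
    have c: "c x \<in> F \<and> x \<notin> c x" if "x \<in> pnat" for x
      unfolding c_def by (rule someI_ex) (use F(3) that in blast)
    then have "finite (c ` pnat)" using F(2) by (meson finite_subset image_subsetI)
    then obtain j where j: "contains_AP (Suc k) {x \<in> pnat. c x = j}"
      using colouring_contains_AP_Suc[OF qb Suc.IH] by blast
    then obtain x where "x \<in> pnat" "c x = j" using contains_AP_Suc_nonempty[OF j] by auto
    then have "j \<in> ?M" using c F(1) by blast
    then obtain N where N: "j = pnat - N" "\<not> contains_AP (Suc k) N" by auto
    have "{x \<in> pnat. c x = j} \<subseteq> N" using c N(1) by auto
    then show False using contains_AP_mono[OF j] N(2) by blast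
  qed
  then obtain p where p: "p \<in> beta pnat" "?M \<subseteq> p" using fip_imp_ultrafilter by blast
  note u = beta_ultrafilter[OF p(1)]
  have "contains_AP (Suc k) B" if B: "B \<in> p" for B
  proof (rule ccontr)
    assume "\<not> contains_AP (Suc k) B"
    then have "pnat - B \<in> p" using p(2) ultrafilter_on_subset[OF u B] by blast
    then show False using ultrafilter_on_compl_iff[OF u] ultrafilter_on_subset[OF u B] B by blast
  qed
  from AP_ideal[OF p(1) this] have "K \<subseteq> {p \<in> beta pnat. \<forall>A\<in>p. contains_AP (Suc k) A}"
    using K(1) unfolding smallest_ideal_def by blast
  then show ?case using K(2) Suc.prems by blast
qed

section \<open>Finite witnesses for progressions and finite sums\<close>

lemma contains_AP_finite_subset:
  assumes "contains_AP k A"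
  obtains B where "finite B" "B \<subseteq> A" "contains_AP k B"
proof -
  from assms obtain a d where *: "a \<in> pnat" "d \<in> pnat" "{a + i * d | i. i < k} \<subseteq> A"
    unfolding contains_AP_def by blast
  show ?thesis by (rule that[of "{a + i * d | i. i < k}"]) (use * in \<open>auto simp: contains_AP_def\<close>)
qed

lemma contains_FS_finite_subset:
  assumes "contains_FS k A"
  obtains B where "finite B" "B \<subseteq> A" "contains_FS k B"
proof -
  from assms obtain f :: "nat \<Rightarrow> nat" where *: "\<forall>i\<in>{1..k}. f i \<in> pnat"
    "{\<Sum>i\<in>F. f i | F. F \<noteq> {} \<and> F \<subseteq> {1..k}} \<subseteq> A" unfolding contains_FS_def by blast
  show ?thesis
  proof (rule that)
    have "{\<Sum>i\<in>F. f i | F. F \<noteq> {} \<and> F \<subseteq> {1..k}} \<subseteq> sum f ` Pow {1..k}" by blast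
    then show "finite {\<Sum>i\<in>F. f i | F. F \<noteq> {} \<and> F \<subseteq> {1..k}}" by (rule finite_subset) simp
    show "contains_FS k {\<Sum>i\<in>F. f i | F. F \<noteq> {} \<and> F \<subseteq> {1..k}}"
      unfolding contains_FS_def using *(1) by blast
  qed (fact *(2))
qed

lemma contains_FS_mono: "contains_FS k A \<Longrightarrow> A \<subseteq> B \<Longrightarrow> contains_FS k B"
  unfolding contains_FS_def by (meson subset_trans)

section \<open>The monochromatic pattern\<close>

theorem theorem1p6:
  fixes c :: "nat \<Rightarrow> 'c"
  assumes "finite (c ` pnat)"
  shows "\<exists>l\<in>pnat. \<forall>k\<in>pnat. \<exists>A B.
           A \<subseteq> pnat \<and> finite A \<and> contains_AP k A \<and> contains_FS k A \<and>
           B \<subseteq> pnat \<and> central_in pnat B \<and>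
           monochromatic c (l *o A \<union> l *o B \<union> l *o (A + B) \<union> A * B)"
proof -
  obtain q where min: "minimal_idempotent pnat q" by (rule pnat.minimal_idempotent_exists)
  then have q: "q \<in> beta pnat" "beta_add pnat q q = q" unfolding minimal_idempotent_def by auto
  note u = beta_ultrafilter[OF q(1)]
  \<comment> \<open>\<open>h n\<close> is the colour of \<open>n * t\<close> for
    \<open>q\<close>-many \<open>t\<close>; the colour \<open>j\<close> obtained below is the value
    of \<open>h\<close> at \<open>q\<close>-many \<open>n\<close>. This expresses that class
    \<open>j\<close> belongs to the multiplicative product of \<open>q\<close> with itself.\<close>
  define h where "h n = (SOME j. {t \<in> pnat. c (n * t) = j} \<in> q)" for n
  have h: "{t \<in> pnat. c (n * t) = h n} \<in> q" if "n \<in> pnat" for n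
  proof -
    have "(\<lambda>t. c (n * t)) ` pnat \<subseteq> c ` pnat" using that by (auto simp: pnat_def)
    then obtain j where "{t \<in> pnat. c (n * t) = j} \<in> q"
      using ultrafilter_on_colour[OF u, of "\<lambda>t. c (n * t)"] assms finite_subset by metis
    then show ?thesis unfolding h_def by (rule someI)
  qed
  have "h n \<in> c ` pnat" if n: "n \<in> pnat" for n
  proof -
    obtain t where "t \<in> pnat" "c (n * t) = h n" using ultrafilter_on_nonempty[OF u h[OF n]] .
    then show ?thesis using n by (auto simp: pnat_def intro!: image_eqI[of _ _ "n * t"])
  qed
  then have "finite (h ` pnat)" using assms finite_subset by (metis image_subsetI)
  then obtain j where E: "{n \<in> pnat. h n = j} \<in> q" using ultrafilter_on_colour[OF u] by blast
  \<comment> \<open>Any \<open>n\<close> with \<open>h n = j\<close> serves as multiplier, so the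
    choice is made before \<open>k\<close> is given.\<close>
  then obtain l where l: "l \<in> pnat" "h l = j" by (rule ultrafilter_on_nonempty[OF u])
  define D where "D = {t \<in> pnat. c (l * t) = j}"
  have D: "D \<in> q" using h[OF l(1)] l(2) unfolding D_def by simp
  \<comment> \<open>For \<open>a \<in> W\<close> the three conditions give colour \<open>j\<close>,
    in this order, to \<open>a * t\<close> for \<open>q\<close>-many \<open>t\<close>, to
    \<open>l * a\<close>, and to \<open>l * (a + t)\<close> for \<open>q\<close>-many
    \<open>t\<close>.\<close>
  define W where "W = {n \<in> pnat. h n = j} \<inter> (D \<inter> {s \<in> pnat. {t \<in> pnat. s + t \<in> D} \<in> q})"
  have W: "W \<in> q"
    unfolding W_def using E D pnat.idempotent_shifts[OF q D] ultrafilter_on_Int[OF u] by blast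
  show ?thesis
  proof (intro bexI[OF _ l(1)] ballI)
    fix k
    obtain A1 where A1: "finite A1" "A1 \<subseteq> W" "contains_AP k A1"
      using contains_AP_finite_subset[OF minimal_idempotent_contains_AP[OF min W]] .
    obtain A2 where A2: "finite A2" "A2 \<subseteq> W" "contains_FS k A2"
      using contains_FS_finite_subset[OF idempotent_contains_FS[OF q W]] .
    define A where "A = A1 \<union> A2"
    have A: "finite A" "A \<subseteq> W" "contains_AP k A" "contains_FS k A"
      using A1 A2 contains_AP_mono contains_FS_mono unfolding A_def by auto
    \<comment> \<open>The three factors take care of \<open>l *o B\<close>,
      \<open>l *o (A + B)\<close> and \<open>A * B\<close>. Finiteness of \<open>A\<close> keeps
      \<open>B\<close> in \<open>q\<close>, which makes it central.\<close>
    define B where "B = D \<inter> ({t \<in> pnat. \<forall>a\<in>A. a + t \<in> D} \<inter> {t \<in> pnat. \<forall>a\<in>A. c (a * t) = j})"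
    have "{t \<in> pnat. \<forall>a\<in>A. a + t \<in> D} \<in> q"
      by (rule ultrafilter_on_Collect_ball[OF u A(1)]) (use A(2) in \<open>auto simp: W_def\<close>)
    moreover have "{t \<in> pnat. \<forall>a\<in>A. c (a * t) = j} \<in> q"
      by (rule ultrafilter_on_Collect_ball[OF u A(1)]) (use A(2) h in \<open>auto simp: W_def\<close>)
    ultimately have B: "B \<in> q" unfolding B_def using D ultrafilter_on_Int[OF u] by blast
    have Bp: "B \<subseteq> pnat" using ultrafilter_on_subset[OF u B] .
    have "c x = j" if "x \<in> l *o A \<union> l *o B \<union> l *o (A + B) \<union> A * B" for x
      using that A(2)
      by (auto simp: elt_set_times_def set_plus_def set_times_def W_def B_def D_def)
    then have "monochromatic c (l *o A \<union> l *o B \<union> l *o (A + B) \<union> A * B)"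
      unfolding monochromatic_def by blast
    moreover have "central_in pnat B" unfolding central_in_def using Bp min B by blast
    moreover have "A \<subseteq> pnat" using A(2) by (auto simp: W_def)
    ultimately show "\<exists>A B. A \<subseteq> pnat \<and> finite A \<and> contains_AP k A \<and> contains_FS k A \<and>
           B \<subseteq> pnat \<and> central_in pnat B \<and>
           monochromatic c (l *o A \<union> l *o B \<union> l *o (A + B) \<union> A * B)"
      using A Bp by blast
  qed
qed

end
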